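(* Let $\mathcal{P}$ be a probability measure on a Hilbert space $\mathcal{H}$, and let $\Delta>0$. If $\mathbb{E}_{\mathcal{P}}\|x\|^2=r^2<\infty$, then the annealed entropy of gap-tolerant classifiers in $\mathcal{H}$, where the gap is $\Delta$, satisfies, for every number of samples $\ell$, $$H_{ann}^{\Lambda}(\ell)\le\left(\ell^{1/2}\left(\frac{r}{\Delta}\right)+1\right)\bigl(1+\ln(\ell+1)\bigr).$$
   Context: A gap-tolerant classifier with gap (margin) $\Delta$ consists of an oriented affine hyperplane together with its margin, the set of points at distance less than $\Delta$ from the hyperplane. Points outside the margin are labeled $+1$ or $-1$ according to the side of the hyperplane on which they lie; points in the margin receive no label and are declared "correct". Let $\Lambda$ be the set of all gap-tolerant classifiers with gap $\Delta$. For points $z_1,\dots,z_\ell$, $N^{\Lambda}(z_1,\dots,z_\ell)$ is the number of labelings of $\{z_1,\dots,z_\ell\}$ by $\pm1$ for which there is a classifier in $\Lambda$ that predicts incorrectly the label of every $z_i$ (so every $z_i$ lies outside the margin, on the side opposite to its label). The annealed entropy with respect to $\mathcal{P}$ is $H_{ann}^{\Lambda}(\ell):=\ln\mathbb{E}\,N^{\Lambda}(z_1,\dots,z_\ell)$, with $z_1,\dots,z_\ell$ i.i.d. from $\mathcal{P}$. *)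

theory Defs
  imports "HOL-Probability.Probability"
begin

(* The normal vector w (any w \<noteq> 0, not necessarily a unit vector) orients the affine
   hyperplane {u. w \<bullet> u = b}.  None is the prediction inside the margin.  For a positive gap,
   no point outside the margin lies on the hyperplane, so the inner "if" is never a tie. *)
definition gap_tolerant_classifier ::
    "real \<Rightarrow> 'a::real_inner \<Rightarrow> real \<Rightarrow> 'a \<Rightarrow> int option" where
  "gap_tolerant_classifier \<Delta> w b x =
     (if infdist x {u. w \<bullet> u = b} < \<Delta> then None
      else Some (if w \<bullet> x > b then 1 else -1))"

definition gap_tolerant_classifiers :: "real \<Rightarrow> ('a::real_inner \<Rightarrow> int option) set" where
  "gap_tolerant_classifiers \<Delta> = {gap_tolerant_classifier \<Delta> w b | w b. w \<noteq> 0}"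

definition predicts_incorrectly :: "('a \<Rightarrow> int option) \<Rightarrow> 'a \<Rightarrow> int \<Rightarrow> bool" where
  "predicts_incorrectly c x y \<longleftrightarrow> (\<exists>v. c x = Some v \<and> v \<noteq> y)"

definition num_labelings :: "('a \<Rightarrow> int option) set \<Rightarrow> nat \<Rightarrow> (nat \<Rightarrow> 'a) \<Rightarrow> nat" where
  "num_labelings \<Lambda> l z =
     card {y \<in> z ` {..<l} \<rightarrow>\<^sub>E {-1, 1}. \<exists>c\<in>\<Lambda>. \<forall>i<l. predicts_incorrectly c (z i) (y (z i))}"

(* On a nonseparable Hilbert space the number of labelings need not be measurable for the
   product of the Borel sigma-algebras, and the Bochner integral would then be 0 by convention.
   The outer expectation is at least as large as any sensible reading of the expectation, and
   equals the integral for every integrable function (outer_expectation_eq).  For a bounded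
   function under a probability measure, the infimum is over a nonempty set bounded below. *)
definition outer_expectation :: "'b measure \<Rightarrow> ('b \<Rightarrow> real) \<Rightarrow> real" where
  "outer_expectation M f =
     (INF g\<in>{g. integrable M g \<and> (\<forall>x\<in>space M. f x \<le> g x)}. \<integral>x. g x \<partial>M)"

lemma outer_expectation_eq:
  assumes "integrable M f"
  shows "outer_expectation M f = (\<integral>x. f x \<partial>M)"
  unfolding outer_expectation_def
proof (rule cInf_eq_minimum)
  show "(\<integral>x. f x \<partial>M) \<in>
      (\<lambda>g. \<integral>x. g x \<partial>M) ` {g. integrable M g \<and> (\<forall>x\<in>space M. f x \<le> g x)}"
    using assms by auto
next
  fix t
  assume "t \<in> (\<lambda>g. \<integral>x. g x \<partial>M) ` {g. integrable M g \<and> (\<forall>x\<in>space M. f x \<le> g x)}"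
  then show "(\<integral>x. f x \<partial>M) \<le> t"
    using assms by (auto intro!: integral_mono)
qed

(* The argument of ln is 0 only if no labeling is possible (the trivial space has no
   hyperplanes, for instance); then ln 0 = 0 here, in place of minus infinity. *)
definition annealed_entropy ::
    "('a \<Rightarrow> int option) set \<Rightarrow> 'a measure \<Rightarrow> nat \<Rightarrow> real" where
  "annealed_entropy \<Lambda> P l =
     ln (outer_expectation (Pi\<^sub>M {..<l} (\<lambda>_. P)) (\<lambda>z. real (num_labelings \<Lambda> l z)))"

end

theory Submission
  imports Defs
begin

text \<open>
  Truncate the sample at radius \<open>R = \<Delta> * sqrt q\<close> with \<open>q\<close> odd. The points of norm at least \<open>R\<close>
  contribute at most a factor 2 each, and by Chebyshev the expectation of the product of these
  factors is at most \<open>(1 + r\<^sup>2 / R\<^sup>2) ^ l\<close>. On the points of norm less than \<open>R\<close>, averaging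
  \<open>norm (\<Sum> \<plusminus> x)\<close> squared over balanced signs, for which the offset of the hyperplane cancels,
  shows that a shattered set of even size \<open>k\<close> satisfies \<open>k - 1 < q\<close>. This estimate fails for odd
  sizes, e.g. for an equilateral triangle, but as \<open>q\<close> is odd every shattered set still has size at
  most \<open>q\<close>, so that Sauer--Shelah gives at most \<open>(l + 1) ^ q\<close> labelings.
\<close>

section \<open>The Sauer--Shelah lemma\<close>

definition shatters :: "'a set set \<Rightarrow> 'a set \<Rightarrow> bool" where
  "shatters F S \<longleftrightarrow> (\<forall>T\<subseteq>S. \<exists>A\<in>F. A \<inter> S = T)"

text \<open>Pajor's form of Sauer--Shelah, by induction on the ground set. The members avoiding
  \<open>x\<close>, and those containing \<open>x\<close> with \<open>x\<close> removed, are two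
  families on \<open>X\<close>; a set shattered by both yields two sets shattered by
  \<open>F\<close>, itself and itself with \<open>x\<close> added.\<close>

lemma card_le_card_shattered:
  assumes "finite X" and "F \<subseteq> Pow X"
  shows "card F \<le> card {S. S \<subseteq> X \<and> shatters F S}"
  using assms
proof (induction X arbitrary: F rule: finite_induct)
  case empty
  then have "F \<subseteq> {S. S \<subseteq> {} \<and> shatters F S}"
    unfolding shatters_def by blast
  then show ?case by (intro card_mono) simp_all
next
  case (insert x X)
  define F0 where "F0 = {A\<in>F. x \<notin> A}"
  define F1 where "F1 = (\<lambda>A. A - {x}) ` {A\<in>F. x \<in> A}"
  define Sh where "Sh G = {S. S \<subseteq> X \<and> shatters G S}" for G
  have fin: "finite F" "\<And>G. finite (Sh G)"
    using insert.hyps(1) finite_subset[OF insert.prems] by (simp_all add: Sh_def)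
  have "F = F0 \<union> {A\<in>F. x \<in> A}" by (auto simp: F0_def)
  moreover have "card F1 = card {A\<in>F. x \<in> A}"
    unfolding F1_def by (rule card_image) (auto simp: inj_on_def)
  moreover have "card (F0 \<union> {A\<in>F. x \<in> A}) = card F0 + card {A\<in>F. x \<in> A}"
    using fin by (intro card_Un_disjoint) (auto simp: F0_def)
  ultimately have "card F = card F0 + card F1" by simp
  also have "\<dots> \<le> card (Sh F0) + card (Sh F1)"
    unfolding Sh_def using insert.prems
    by (intro add_mono insert.IH) (auto simp: F0_def F1_def)
  \<comment> \<open>Sets shattered by both families are counted twice; the second copy is moved to a
    set containing \<open>x\<close>, which makes the union disjoint.\<close>
  also have "\<dots> = card (Sh F0 \<union> Sh F1) + card (insert x ` (Sh F0 \<inter> Sh F1))"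
  proof -
    have "card (insert x ` (Sh F0 \<inter> Sh F1)) = card (Sh F0 \<inter> Sh F1)"
      using insert.hyps(2) by (intro card_image) (auto simp: inj_on_def Sh_def)
    then show ?thesis using fin card_Un_Int[of "Sh F0" "Sh F1"] by simp
  qed
  also have "\<dots> = card ((Sh F0 \<union> Sh F1) \<union> insert x ` (Sh F0 \<inter> Sh F1))"
    using insert.hyps(2) fin by (intro card_Un_disjoint[symmetric]) (auto simp: Sh_def)
  also have "\<dots> \<le> card {S. S \<subseteq> insert x X \<and> shatters F S}"
  proof (intro card_mono subsetI)
    show "finite {S. S \<subseteq> insert x X \<and> shatters F S}"
      using insert.hyps(1) by auto
  next
    fix S assume "S \<in> (Sh F0 \<union> Sh F1) \<union> insert x ` (Sh F0 \<inter> Sh F1)"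
    then consider "S \<in> Sh F0" | "S \<in> Sh F1"
      | S' where "S = insert x S'" "S' \<in> Sh F0" "S' \<in> Sh F1"
      by auto
    then have "S \<subseteq> insert x X \<and> shatters F S"
    proof cases
      case 1
      then have "S \<subseteq> X" "\<forall>T\<subseteq>S. \<exists>A\<in>F0. A \<inter> S = T"
        by (simp_all add: Sh_def shatters_def)
      then show ?thesis unfolding shatters_def F0_def by blast
    next
      case 2
      then have S: "S \<subseteq> X" "\<forall>T\<subseteq>S. \<exists>A\<in>F1. A \<inter> S = T"
        by (simp_all add: Sh_def shatters_def)
      have "\<exists>A\<in>F. A \<inter> S = T" if T: "T \<subseteq> S" for T
      proof -
        obtain A where "A \<in> F" "(A - {x}) \<inter> S = T"
          using S(2) T unfolding F1_def by blast
        moreover have "x \<notin> S" using S(1) insert.hyps(2) by blast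
        ultimately show ?thesis by blast
      qed
      then show ?thesis using S(1) unfolding shatters_def by blast
    next
      case 3
      then have S': "S' \<subseteq> X" "\<forall>T\<subseteq>S'. \<exists>A\<in>F0. A \<inter> S' = T" "\<forall>T\<subseteq>S'. \<exists>A\<in>F1. A \<inter> S' = T"
        by (simp_all add: Sh_def shatters_def)
      have "\<exists>A\<in>F. A \<inter> S = T" if T: "T \<subseteq> S" for T
      \<comment> \<open>Traces containing \<open>x\<close> come from \<open>F1\<close> with
        \<open>x\<close> put back, the others from \<open>F0\<close>.\<close>
      proof (cases "x \<in> T")
        case True
        have "T - {x} \<subseteq> S'" using T 3(1) by blast
        then obtain A where A: "A \<in> F" "x \<in> A" "(A - {x}) \<inter> S' = T - {x}"
          using S'(3) unfolding F1_def by blast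
        have "x \<notin> S'" using S'(1) insert.hyps(2) by blast
        then have "A \<inter> S = T" using A True 3(1) by blast
        then show ?thesis using A by blast
      next
        case False
        then have "T \<subseteq> S'" using T 3(1) by blast
        then obtain A where A: "A \<in> F" "x \<notin> A" "A \<inter> S' = T"
          using S'(2) unfolding F0_def by blast
        then have "A \<inter> S = T" using 3(1) by blast
        then show ?thesis using A by blast
      qed
      then show ?thesis using 3(1) S'(1) unfolding shatters_def by blast
    qed
    then show "S \<in> {S. S \<subseteq> insert x X \<and> shatters F S}" by simp
  qed
  finally show ?case .
qed

text \<open>Each increase of \<open>d\<close> allows adding one more element or none. The choice of
  adding none is encoded by \<open>None\<close> and accounts for the \<open>+ 1\<close> in the
  base.\<close>

lemma card_small_subsets_le:
  assumes "finite X"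
  shows "card {S. S \<subseteq> X \<and> card S \<le> d} \<le> (card X + 1) ^ d"
proof (induction d)
  case 0
  have "{S. S \<subseteq> X \<and> card S \<le> 0} = {{}}"
    using assms by (auto dest: finite_subset)
  then show ?case by simp
next
  case (Suc d)
  let ?P = "\<lambda>d. {S. S \<subseteq> X \<and> card S \<le> d}"
  let ?f = "\<lambda>(S, x). case x of None \<Rightarrow> S | Some a \<Rightarrow> insert a S"
  let ?X = "insert None (Some ` X)"
  have "?P (Suc d) \<subseteq> ?f ` (?P d \<times> ?X)"
  proof
    fix S assume S: "S \<in> ?P (Suc d)"
    show "S \<in> ?f ` (?P d \<times> ?X)"
    proof (cases "card S \<le> d")
      case True
      then show ?thesis using S by (intro image_eqI[of _ _ "(S, None)"]) auto
    next
      case False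
      then obtain a where a: "a \<in> S" using S by fastforce
      moreover have "finite S" using S assms by (auto intro: finite_subset)
      ultimately have "card (S - {a}) \<le> d" using S by (auto simp: card_Diff_singleton)
      then show ?thesis using S a
        by (intro image_eqI[of _ _ "(S - {a}, Some a)"]) auto
    qed
  qed
  then have "card (?P (Suc d)) \<le> card (?P d \<times> ?X)"
    using assms by (intro surj_card_le) auto
  also have "\<dots> = card (?P d) * (card X + 1)"
    using assms by (simp add: card_cartesian_product card_image)
  also have "\<dots> \<le> (card X + 1) ^ Suc d"
    using mult_le_mono1[OF Suc] by (simp only: power_Suc2)
  finally show ?case .
qed

lemma sauer_shelah:
  assumes "finite X" and "F \<subseteq> Pow X"
    and "\<And>S. S \<subseteq> X \<Longrightarrow> shatters F S \<Longrightarrow> card S \<le> d"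
  shows "card F \<le> (card X + 1) ^ d"
proof -
  have "card F \<le> card {S. S \<subseteq> X \<and> shatters F S}"
    by (rule card_le_card_shattered) fact+
  also have "\<dots> \<le> card {S. S \<subseteq> X \<and> card S \<le> d}"
    using assms by (intro card_mono) auto
  also have "\<dots> \<le> (card X + 1) ^ d"
    by (rule card_small_subsets_le) fact
  finally show ?thesis .
qed

section \<open>Balanced signs\<close>

definition split_sign :: "'a set \<Rightarrow> 'a \<Rightarrow> real" where
  "split_sign T x = (if x \<in> T then 1 else -1)"

lemma sum_split_sign_balanced:
  assumes "finite S" and "T \<subseteq> S" and "card S = 2 * card T"
  shows "(\<Sum>x\<in>S. split_sign T x) = 0"
proof -
  have "(\<Sum>x\<in>S. split_sign T x) = (\<Sum>x\<in>T. split_sign T x) + (\<Sum>x\<in>S - T. split_sign T x)"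
    using assms by (metis add.commute sum.subset_diff)
  also have "\<dots> = real (card T) - real (card (S - T))"
    by (simp add: split_sign_def)
  also have "\<dots> = 0"
    using assms by (simp add: card_Diff_subset finite_subset)
  finally show ?thesis .
qed

text \<open>By symmetry under transpositions the correlation does not depend on \<open>y\<close>, and the
  correlations with all the points add up to zero.\<close>
lemma sum_split_sign_correlation:
  assumes S: "finite S" "card S = 2 * j" and xy: "x \<in> S" "y \<in> S" "x \<noteq> y"
  shows "real (card S - 1) * (\<Sum>T | T \<subseteq> S \<and> card T = j. split_sign T x * split_sign T y)
           = - real (card {T. T \<subseteq> S \<and> card T = j})"
proof -
  let ?B = "{T. T \<subseteq> S \<and> card T = j}"
  define M where "M u = (\<Sum>T\<in>?B. split_sign T x * split_sign T u)" for u
  have M_eq: "M u = M y" if u: "u \<in> S - {x}" for u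
  proof -
    \<comment> \<open>As \<open>u\<close> and \<open>y\<close> both differ from \<open>x\<close>,
      this transposition fixes \<open>x\<close>; taking images under it is an involution of the
      balanced splits that carries \<open>M u\<close> to \<open>M y\<close>.\<close>
    let ?\<tau> = "Transposition.transpose u y"
    have inv: "?\<tau> ` ?\<tau> ` T = T" for T by (simp add: image_image)
    have maps: "?\<tau> ` T \<in> ?B" if "T \<in> ?B" for T
    proof -
      have "card (?\<tau> ` T) = card T" by (intro card_image) simp
      moreover have "?\<tau> ` T \<subseteq> S"
        using that u xy by (auto simp: Transposition.transpose_def)
      ultimately show ?thesis using that by simp
    qed
    have mem: "v \<in> ?\<tau> ` T \<longleftrightarrow> ?\<tau> v \<in> T" for v T
      by (metis imageE imageI transpose_involutory)
    show ?thesis unfolding M_def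
    proof (rule sum.reindex_bij_witness[of _ "image ?\<tau>" "image ?\<tau>"])
      fix T
      have "?\<tau> x = x" "?\<tau> y = u"
        using u xy by (auto simp: Transposition.transpose_def)
      then show "split_sign (?\<tau> ` T) x * split_sign (?\<tau> ` T) y = split_sign T x * split_sign T u"
        by (simp only: split_sign_def mem)
    qed (assumption | rule inv maps)+
  qed
  have "M x = real (card ?B)"
    by (simp add: M_def split_sign_def if_distrib cong: if_cong)
  moreover have "(\<Sum>u\<in>S. M u) = 0"
  proof -
    have "(\<Sum>u\<in>S. M u) = (\<Sum>T\<in>?B. split_sign T x * (\<Sum>u\<in>S. split_sign T u))"
      unfolding M_def by (subst sum.swap) (simp add: sum_distrib_left)
    also have "\<dots> = 0"
      using S by (intro sum.neutral) (auto simp: sum_split_sign_balanced)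
    finally show ?thesis .
  qed
  moreover have "(\<Sum>u\<in>S. M u) = M x + (\<Sum>u\<in>S - {x}. M u)"
    using S xy by (simp add: sum.remove)
  moreover have "(\<Sum>u\<in>S - {x}. M u) = real (card S - 1) * M y"
  proof -
    have "(\<Sum>u\<in>S - {x}. M u) = (\<Sum>u\<in>S - {x}. M y)"
      by (rule sum.cong[OF refl M_eq])
    then show ?thesis using xy S by (simp add: card_Diff_singleton)
  qed
  ultimately show ?thesis by (simp add: M_def)
qed

text \<open>Expand the squared norms. After scaling by \<open>card S - 1\<close>, every off-diagonal
  coefficient is minus the number of splits, so the total is a multiple of the sum of squared norms
  minus a multiple of \<open>(norm (\<Sum>x\<in>S. x))\<^sup>2\<close>, which is dropped.\<close>

lemma sum_norm_balanced_le:
  fixes S :: "'a::real_inner set"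
  assumes S: "finite S" "card S = 2 * j" "S \<noteq> {}"
  shows "real (card S - 1) * (\<Sum>T | T \<subseteq> S \<and> card T = j. (norm (\<Sum>x\<in>S. split_sign T x *\<^sub>R x))\<^sup>2)
           \<le> real (card {T. T \<subseteq> S \<and> card T = j}) * real (card S) * (\<Sum>x\<in>S. (norm x)\<^sup>2)"
proof -
  let ?B = "{T. T \<subseteq> S \<and> card T = j}"
  let ?k = "real (card S - 1)"
  define N where "N = real (card ?B)"
  have k: "real (card S) = ?k + 1"
    using S(1,3) by (simp add: Suc_leI card_gt_0_iff of_nat_diff)
  have expand: "(norm (\<Sum>x\<in>S. c x *\<^sub>R x))\<^sup>2 = (\<Sum>x\<in>S. \<Sum>y\<in>S. (c x * c y) * (x \<bullet> y))"
    for c :: "'a \<Rightarrow> real"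
    by (simp add: power2_norm_eq_inner inner_sum_left inner_sum_right sum_distrib_left mult.assoc)
      (simp add: inner_commute)
  have "?k * (\<Sum>T\<in>?B. (norm (\<Sum>x\<in>S. split_sign T x *\<^sub>R x))\<^sup>2)
      = ?k * (\<Sum>T\<in>?B. \<Sum>x\<in>S. \<Sum>y\<in>S. (split_sign T x * split_sign T y) * (x \<bullet> y))"
    by (simp only: expand)
  also have "\<dots> = ?k * (\<Sum>x\<in>S. \<Sum>T\<in>?B. \<Sum>y\<in>S. (split_sign T x * split_sign T y) * (x \<bullet> y))"
    by (subst sum.swap) simp
  also have "\<dots> = ?k * (\<Sum>x\<in>S. \<Sum>y\<in>S. \<Sum>T\<in>?B. (split_sign T x * split_sign T y) * (x \<bullet> y))"
    by (subst (2) sum.swap) simp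
  also have "\<dots> = (\<Sum>x\<in>S. \<Sum>y\<in>S. (?k * (\<Sum>T\<in>?B. split_sign T x * split_sign T y)) * (x \<bullet> y))"
    by (simp add: sum_distrib_left sum_distrib_right mult.assoc)
  \<comment> \<open>The coefficient is written as the constant \<open>- N\<close> plus a diagonal
    correction, so that the constant part sums to a perfect square.\<close>
  also have "\<dots> = (\<Sum>x\<in>S. \<Sum>y\<in>S. (if x = y then N * real (card S) * (norm x)\<^sup>2 else 0) - N * (x \<bullet> y))"
  proof (intro sum.cong refl)
    fix x y assume xy: "x \<in> S" "y \<in> S"
    show "(?k * (\<Sum>T\<in>?B. split_sign T x * split_sign T y)) * (x \<bullet> y)
        = (if x = y then N * real (card S) * (norm x)\<^sup>2 else 0) - N * (x \<bullet> y)"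
    proof (cases "x = y")
      case True
      have "(\<Sum>T\<in>?B. split_sign T y * split_sign T y) = N"
        by (simp add: N_def split_sign_def if_distrib cong: if_cong)
      then show ?thesis using True
        by (simp only: k) (simp add: power2_norm_eq_inner algebra_simps)
    next
      case False
      then show ?thesis
        using sum_split_sign_correlation[OF S(1,2) xy False] by (simp add: N_def)
    qed
  qed
  also have "\<dots> = N * real (card S) * (\<Sum>x\<in>S. (norm x)\<^sup>2) - N * (norm (\<Sum>x\<in>S. x))\<^sup>2"
    using S(1) expand[of "\<lambda>_. 1"] by (simp add: sum_subtractf sum.delta sum_distrib_left)
  also have "\<dots> \<le> N * real (card S) * (\<Sum>x\<in>S. (norm x)\<^sup>2)"
    by (simp add: N_def)
  finally show ?thesis by (simp add: N_def)
qed

section \<open>Separation with a margin\<close>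

text \<open>Scaling the gap by \<open>norm w\<close> spares normalizing \<open>w\<close>.
  \<open>T\<close> lies on the negative side because it will hold the points labeled 1, which an
  incorrect classifier predicts as -1.\<close>

definition margin_separated :: "real \<Rightarrow> 'a::real_inner set \<Rightarrow> 'a set \<Rightarrow> bool" where
  "margin_separated \<Delta> T U \<longleftrightarrow> (\<exists>w b. w \<noteq> 0 \<and>
     (\<forall>x\<in>T. w \<bullet> x + \<Delta> * norm w \<le> b) \<and> (\<forall>x\<in>U. b + \<Delta> * norm w \<le> w \<bullet> x))"

lemma margin_separated_mono:
  "margin_separated \<Delta> T U \<Longrightarrow> T' \<subseteq> T \<Longrightarrow> U' \<subseteq> U \<Longrightarrow> margin_separated \<Delta> T' U'"
  unfolding margin_separated_def by blast

text \<open>The witness \<open>p\<close> is the orthogonal projection of \<open>x\<close>. This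
  turns the margin condition of a classifier into a linear inequality in
  \<open>w \<bullet> x\<close>.\<close>

lemma infdist_hyperplane_le:
  fixes w x :: "'a::real_inner"
  assumes "w \<noteq> 0"
  shows "infdist x {u. w \<bullet> u = b} * norm w \<le> \<bar>w \<bullet> x - b\<bar>"
proof -
  define p where "p = x - ((w \<bullet> x - b) / (w \<bullet> w)) *\<^sub>R w"
  have "w \<bullet> p = b" using assms by (simp add: p_def inner_diff_right)
  then have "infdist x {u. w \<bullet> u = b} \<le> dist x p" by (intro infdist_le) simp
  also have "\<dots> = \<bar>w \<bullet> x - b\<bar> / norm w"
    using assms by (simp add: p_def dist_norm dot_square_norm power2_eq_square)
  finally show ?thesis using assms by (simp add: pos_le_divide_eq)
qed

text \<open>An incorrect prediction is in particular a prediction, so every point is at distance at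
  least \<Delta> from the hyperplane; being wrong puts label 1 on the side
  \<open>w \<bullet> x \<le> b\<close>.\<close>

lemma gap_tolerant_incorrect_margin_separated:
  assumes "c \<in> gap_tolerant_classifiers \<Delta>"
    and "\<And>x. x \<in> A \<Longrightarrow> predicts_incorrectly c x (y x)"
    and "\<And>x. x \<in> A \<Longrightarrow> y x \<in> {-1, 1}"
  shows "margin_separated \<Delta> {x\<in>A. y x = 1} {x\<in>A. y x \<noteq> 1}"
proof -
  obtain w b where w: "w \<noteq> 0" and c: "c = gap_tolerant_classifier \<Delta> w b"
    using assms(1) by (auto simp: gap_tolerant_classifiers_def)
  have "\<Delta> * norm w \<le> \<bar>w \<bullet> x - b\<bar> \<and> (y x = 1 \<longleftrightarrow> w \<bullet> x \<le> b)" if x: "x \<in> A" for x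
  proof -
    have far: "\<not> infdist x {u. w \<bullet> u = b} < \<Delta>" and "(if w \<bullet> x > b then 1 else -1) \<noteq> y x"
      using assms(2)[OF x]
      by (auto simp: c predicts_incorrectly_def gap_tolerant_classifier_def split: if_splits)
    moreover have "\<Delta> * norm w \<le> infdist x {u. w \<bullet> u = b} * norm w"
      using far by (intro mult_right_mono) auto
    ultimately show ?thesis
      using infdist_hyperplane_le[OF w, of x b] assms(3)[OF x] by (auto split: if_splits)
  qed
  then show ?thesis unfolding margin_separated_def using w
    by (intro exI[of _ w] exI[of _ b]) fastforce
qed

text \<open>Add up the margin inequalities, signed so that each term is at least
  \<open>\<Delta> * norm w\<close>; Cauchy--Schwarz then removes the dependence on
  \<open>w\<close>.\<close>

lemma norm_balanced_ge:
  fixes S :: "'a::real_inner set"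
  assumes S: "finite S" and T: "T \<subseteq> S" "card S = 2 * card T"
    and sep: "margin_separated \<Delta> T (S - T)"
  shows "real (card S) * \<Delta> \<le> norm (\<Sum>x\<in>S. split_sign T x *\<^sub>R x)"
proof -
  obtain w b where w: "w \<noteq> 0" and in_T: "\<And>x. x \<in> T \<Longrightarrow> w \<bullet> x + \<Delta> * norm w \<le> b"
    and out_T: "\<And>x. x \<in> S - T \<Longrightarrow> b + \<Delta> * norm w \<le> w \<bullet> x"
    using sep by (auto simp: margin_separated_def)
  have "real (card S) * \<Delta> * norm w = (\<Sum>x\<in>S. \<Delta> * norm w)" by simp
  also have "\<dots> \<le> (\<Sum>x\<in>S. split_sign T x * (b - w \<bullet> x))"
    using in_T out_T by (intro sum_mono) (force simp: split_sign_def)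
  also have "\<dots> = b * (\<Sum>x\<in>S. split_sign T x) - w \<bullet> (\<Sum>x\<in>S. split_sign T x *\<^sub>R x)"
    by (simp add: inner_sum_right sum_subtractf sum_distrib_left right_diff_distrib mult.commute)
  \<comment> \<open>The signs of a balanced split add up to zero, so the unknown offset
    \<open>b\<close> disappears.\<close>
  also have "\<dots> = - (w \<bullet> (\<Sum>x\<in>S. split_sign T x *\<^sub>R x))"
    using S T by (simp add: sum_split_sign_balanced)
  also have "\<dots> \<le> norm (\<Sum>x\<in>S. split_sign T x *\<^sub>R x) * norm w"
    using Cauchy_Schwarz_ineq2[of w "\<Sum>x\<in>S. split_sign T x *\<^sub>R x"] by (simp add: mult.commute)
  finally show ?thesis using w by simp
qed

text \<open>With \<open>k = card S\<close>, the average over balanced splits of the squared norm of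
  the signed sum is at least \<open>(k * \<Delta>)\<^sup>2\<close> by separation and less than
  \<open>k\<^sup>2 * R\<^sup>2 / (k - 1)\<close> by the expansion.\<close>

lemma margin_shattered_even_card:
  fixes S :: "'a::real_inner set"
  assumes S: "finite S" "card S = 2 * j" "S \<noteq> {}" and "\<Delta> > 0"
    and ball: "\<And>x. x \<in> S \<Longrightarrow> norm x < R"
    and sep: "\<And>T. T \<subseteq> S \<Longrightarrow> margin_separated \<Delta> T (S - T)"
  shows "(real (card S) - 1) * \<Delta>\<^sup>2 < R\<^sup>2"
proof -
  let ?B = "{T. T \<subseteq> S \<and> card T = j}"
  let ?k = "real (card S)"
  have k: "real (card S - 1) = ?k - 1" "?k > 0"
    using S(1,3) by (simp_all add: Suc_leI card_gt_0_iff of_nat_diff)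
  have fB: "finite ?B" using S(1) by simp
  \<comment> \<open>A balanced split exists, so the factor \<open>card ?B\<close> is positive and
    can be cancelled at the end.\<close>
  have "j \<le> card S" using S(2) by simp
  then obtain T where "T \<subseteq> S" "card T = j"
    by (rule obtain_subset_with_card_n)
  then have N: "real (card ?B) > 0"
    using fB by (auto simp: card_gt_0_iff)
  have R: "R > 0" using ball S(3) norm_ge_zero le_less_trans by blast
  have "real (card ?B) * ((?k - 1) * (?k * \<Delta>)\<^sup>2) = (?k - 1) * (\<Sum>T\<in>?B. (?k * \<Delta>)\<^sup>2)"
    by simp
  also have "\<dots> \<le> (?k - 1) * (\<Sum>T\<in>?B. (norm (\<Sum>x\<in>S. split_sign T x *\<^sub>R x))\<^sup>2)"
  proof (intro mult_left_mono sum_mono power_mono)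
    fix T assume T: "T \<in> ?B"
    then show "?k * \<Delta> \<le> norm (\<Sum>x\<in>S. split_sign T x *\<^sub>R x)"
      using S sep by (intro norm_balanced_ge) auto
  qed (use \<open>\<Delta> > 0\<close> k in auto)
  also have "\<dots> \<le> real (card ?B) * ?k * (\<Sum>x\<in>S. (norm x)\<^sup>2)"
    using sum_norm_balanced_le[OF S] by (simp only: k)
  \<comment> \<open>Strict since all norms are below \<open>R\<close> and \<open>S\<close> is
    nonempty; the boundary case of the cardinality bound rests on this.\<close>
  also have "\<dots> < real (card ?B) * ?k * (\<Sum>x\<in>S. R\<^sup>2)"
    using N k S ball
    by (intro mult_strict_left_mono sum_strict_mono power_strict_mono) auto
  finally have "real (card ?B) * ?k\<^sup>2 * ((?k - 1) * \<Delta>\<^sup>2) < real (card ?B) * ?k\<^sup>2 * R\<^sup>2"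
    by (simp add: power2_eq_square mult_ac)
  moreover have "real (card ?B) * ?k\<^sup>2 > 0"
    using N k by simp
  ultimately show ?thesis
    by (simp only: mult_less_cancel_left_pos)
qed

text \<open>A larger set would contain a subset of even size \<open>2 * (j + 1)\<close> with all
  splits separated, and the even bound would read \<open>(2 * j + 1) * \<Delta>\<^sup>2 < (2 * j +
  1) * \<Delta>\<^sup>2\<close>.\<close>

lemma margin_shattered_card_le:
  fixes S :: "'a::real_inner set"
  assumes S: "finite S" and \<Delta>: "\<Delta> > 0"
    and ball: "\<And>x. x \<in> S \<Longrightarrow> norm x < \<Delta> * sqrt (real (2 * j + 1))"
    and sep: "\<And>T. T \<subseteq> S \<Longrightarrow> margin_separated \<Delta> T (S - T)"
  shows "card S \<le> 2 * j + 1"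
proof (rule ccontr)
  assume "\<not> card S \<le> 2 * j + 1"
  then obtain S' where S': "S' \<subseteq> S" "card S' = 2 * (j + 1)" "finite S'"
    using obtain_subset_with_card_n[of "2 * (j + 1)" S] by auto
  have "(real (card S') - 1) * \<Delta>\<^sup>2 < (\<Delta> * sqrt (real (2 * j + 1)))\<^sup>2"
  proof (rule margin_shattered_even_card[OF S'(3,2) _ \<Delta>])
    fix T assume "T \<subseteq> S'"
    then show "margin_separated \<Delta> T (S' - T)"
      using S' by (intro margin_separated_mono[OF sep[of T]]) auto
  qed (use S' ball in auto)
  then show False
    using S' by (simp add: power_mult_distrib algebra_simps)
qed

text \<open>A hyperplane separating a split of \<open>C\<close> also separates its trace on any
  subset, so a set shattered by this family has all its own splits separated and hence bounded size;
  Sauer--Shelah applies.\<close>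

lemma card_margin_separated_le:
  fixes C :: "'a::real_inner set"
  assumes "finite C" and "\<Delta> > 0"
    and "\<And>x. x \<in> C \<Longrightarrow> norm x < \<Delta> * sqrt (real (2 * j + 1))"
  shows "card {T. T \<subseteq> C \<and> margin_separated \<Delta> T (C - T)} \<le> (card C + 1) ^ (2 * j + 1)"
proof (rule sauer_shelah)
  fix S assume S: "S \<subseteq> C" and sh: "shatters {T. T \<subseteq> C \<and> margin_separated \<Delta> T (C - T)} S"
  show "card S \<le> 2 * j + 1"
  proof (rule margin_shattered_card_le[OF _ \<open>\<Delta> > 0\<close>])
    fix T assume "T \<subseteq> S"
    then obtain A where A: "A \<inter> S = T" "margin_separated \<Delta> A (C - A)"
      using sh by (auto simp: shatters_def)
    then show "margin_separated \<Delta> T (S - T)"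
      using S by (intro margin_separated_mono[OF A(2)]) auto
  qed (use assms S in \<open>auto intro: finite_subset\<close>)
qed (use assms in auto)

section \<open>Counting labelings\<close>

lemma num_labelings_le:
  fixes z :: "nat \<Rightarrow> 'a::real_inner" and j :: nat
  assumes "\<Delta> > 0"
  defines "R \<equiv> \<Delta> * sqrt (real (2 * j + 1))"
  shows "real (num_labelings (gap_tolerant_classifiers \<Delta>) l z)
           \<le> (real l + 1) ^ (2 * j + 1) * (\<Prod>i<l. if R \<le> norm (z i) then 2 else 1)"
proof -
  define A where "A = z ` {..<l}"
  define B where "B = {x\<in>A. R \<le> norm x}"
  define C where "C = {x\<in>A. norm x < R}"
  define Y where "Y = {y \<in> A \<rightarrow>\<^sub>E {-1, 1::int}.
    \<exists>c\<in>gap_tolerant_classifiers \<Delta>. \<forall>i<l. predicts_incorrectly c (z i) (y (z i))}"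
  define D where "D = {T. T \<subseteq> C \<and> margin_separated \<Delta> T (C - T)}"
  define f where "f y = ({x\<in>B. y x = (1::int)}, {x\<in>C. y x = 1})" for y
  have fin: "finite A" "finite B" "finite C" by (auto simp: A_def B_def C_def)
  have AB: "A = B \<union> C" by (auto simp: B_def C_def)
  have finD: "finite D" using fin by (auto simp: D_def)
  have "inj_on f Y"
  proof (rule inj_onI)
    fix y y' assume Y: "y \<in> Y" "y' \<in> Y" and eq: "f y = f y'"
    have "y x = y' x" if "x \<in> A" for x
    proof -
      have "y x = 1 \<longleftrightarrow> y' x = 1"
        using eq that by (auto simp: f_def AB set_eq_iff)
      moreover have "y x \<in> {-1, 1}" "y' x \<in> {-1, 1}"
        using Y that by (auto simp: Y_def dest: PiE_mem)
      ultimately show ?thesis by auto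
    qed
    then show "y = y'" using Y by (intro PiE_ext[of y A _ y']) (auto simp: Y_def)
  qed
  moreover have "f ` Y \<subseteq> Pow B \<times> D"
  proof safe
    fix y a b assume y: "y \<in> Y" and ab: "(a, b) = f y"
    obtain c where c: "c \<in> gap_tolerant_classifiers \<Delta>"
      "\<forall>i<l. predicts_incorrectly c (z i) (y (z i))"
      using y by (auto simp: Y_def)
    have "margin_separated \<Delta> {x\<in>C. y x = 1} {x\<in>C. y x \<noteq> 1}"
    proof (rule gap_tolerant_incorrect_margin_separated[OF c(1)])
      fix x assume "x \<in> C"
      then have "x \<in> A" by (simp add: C_def)
      then show "predicts_incorrectly c x (y x)" "y x \<in> {-1, 1}"
        using c(2) y by (auto simp: Y_def A_def dest: PiE_mem)
    qed
    moreover have "C - {x\<in>C. y x = 1} = {x\<in>C. y x \<noteq> 1}" by auto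
    ultimately show "b \<in> D" using ab by (simp add: f_def D_def)
    fix x assume "x \<in> a"
    then show "x \<in> B" using ab by (simp add: f_def)
  qed
  ultimately have "card Y \<le> card (Pow B \<times> D)"
    using fin finD by (intro card_inj_on_le) auto
  also have "\<dots> = 2 ^ card B * card D"
    using fin by (simp add: card_cartesian_product card_Pow)
  \<comment> \<open>Sample points may coincide, so the cardinalities of \<open>B\<close> and
    \<open>C\<close> are bounded by numbers of indices.\<close>
  also have "\<dots> \<le> 2 ^ card {i. i < l \<and> R \<le> norm (z i)} * (l + 1) ^ (2 * j + 1)"
  proof (intro mult_mono power_increasing)
    have "B = z ` {i. i < l \<and> R \<le> norm (z i)}" by (auto simp: B_def A_def)
    then show "card B \<le> card {i. i < l \<and> R \<le> norm (z i)}"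
      by (simp add: card_image_le)
    have "card C \<le> card A" using fin by (intro card_mono) (auto simp: AB)
    also have "\<dots> \<le> l" unfolding A_def using card_image_le[of "{..<l}" z] by simp
    finally have C: "card C \<le> l" .
    have "card D \<le> (card C + 1) ^ (2 * j + 1)"
      unfolding D_def using fin \<open>\<Delta> > 0\<close>
      by (intro card_margin_separated_le) (auto simp: C_def R_def)
    also have "\<dots> \<le> (l + 1) ^ (2 * j + 1)"
      using C by (intro power_mono) auto
    finally show "card D \<le> (l + 1) ^ (2 * j + 1)" .
  qed auto
  finally have "real (card Y)
      \<le> 2 ^ card {i. i < l \<and> R \<le> norm (z i)} * (real l + 1) ^ (2 * j + 1)"
    by (simp only: of_nat_le_iff[symmetric, where 'a=real] of_nat_mult of_nat_power of_nat_add
        of_nat_numeral of_nat_1)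
  moreover have "(\<Prod>i<l. if R \<le> norm (z i) then 2 else 1) = (2::real) ^ card {i. i < l \<and> R \<le> norm (z i)}"
    by (simp add: prod.If_cases Int_def conj_commute)
  ultimately show ?thesis by (simp add: num_labelings_def Y_def A_def mult.commute)
qed

section \<open>The expected number of labelings\<close>

text \<open>Nonnegativity of \<open>f\<close> bounds the integrals of all majorants below by 0, so
  the infimum is a genuine lower bound.\<close>

lemma outer_expectation_le:
  assumes "integrable M g" and "\<And>x. x \<in> space M \<Longrightarrow> f x \<le> g x"
    and "\<And>x. x \<in> space M \<Longrightarrow> 0 \<le> f x"
  shows "outer_expectation M f \<le> (\<integral>x. g x \<partial>M)"
  unfolding outer_expectation_def
proof (rule cINF_lower)
  show "bdd_below ((\<lambda>g. \<integral>x. g x \<partial>M) ` {g. integrable M g \<and> (\<forall>x\<in>space M. f x \<le> g x)})"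
    using assms(3) by (intro bdd_belowI2[of _ 0] Bochner_Integration.integral_nonneg) (blast intro: order_trans)
qed (use assms in simp)

text \<open>The majorant \<open>g\<close> ensures that the infimum ranges over a nonempty
  set.\<close>

lemma outer_expectation_nonneg:
  assumes "integrable M g" and "\<And>x. x \<in> space M \<Longrightarrow> f x \<le> g x"
    and "\<And>x. x \<in> space M \<Longrightarrow> 0 \<le> f x"
  shows "0 \<le> outer_expectation M f"
  unfolding outer_expectation_def
proof (rule cINF_greatest)
  show "{g. integrable M g \<and> (\<forall>x\<in>space M. f x \<le> g x)} \<noteq> {}"
    using assms by blast
next
  fix h assume "h \<in> {g. integrable M g \<and> (\<forall>x\<in>space M. f x \<le> g x)}"
  then show "0 \<le> (\<integral>x. h x \<partial>M)"
    using assms(3) by (intro Bochner_Integration.integral_nonneg) (blast intro: order_trans)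
qed

lemma integrable_norm_threshold:
  fixes M :: "'a::real_normed_vector measure"
  assumes "finite_measure M" and "sets M = sets borel"
  shows "integrable M (\<lambda>x. if R \<le> norm x then 2 else 1 :: real)"
proof -
  have "closed {x::'a. R \<le> norm x}"
    by (intro closed_Collect_le continuous_intros)
  then have "{x. R \<le> norm x} \<in> sets M"
    using assms(2) by (simp only: borel_closed)
  then have "integrable M (\<lambda>x. 1 + indicator {x. R \<le> norm x} x :: real)"
    using assms(1)
    by (intro Bochner_Integration.integrable_add finite_measure.integrable_const
        integrable_real_indicator) (simp_all add: finite_measure.emeasure_finite less_top[symmetric])
  moreover have "(\<lambda>x::'a. if R \<le> norm x then 2 else 1 :: real)
      = (\<lambda>x. 1 + indicator {x. R \<le> norm x} x)"
    by (simp add: fun_eq_iff indicator_def)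
  ultimately show ?thesis by (simp only:)
qed

text \<open>Chebyshev's inequality in pointwise form: where the integrand is 2,
  \<open>(norm x)\<^sup>2 / R\<^sup>2\<close> is at least 1.\<close>

lemma integral_norm_threshold_le:
  fixes M :: "'a::real_normed_vector measure"
  assumes "prob_space M" and "sets M = sets borel" and "R > 0"
    and int: "integrable M (\<lambda>x. (norm x)\<^sup>2)"
  shows "(\<integral>x. (if R \<le> norm x then 2 else 1) \<partial>M) \<le> 1 + (\<integral>x. (norm x)\<^sup>2 \<partial>M) / R\<^sup>2"
proof -
  have fin: "finite_measure M"
    using assms(1) by (rule prob_space.finite_measure)
  have int': "integrable M (\<lambda>x. 1 + (norm x)\<^sup>2 / R\<^sup>2)"
    using int by (intro Bochner_Integration.integrable_add finite_measure.integrable_const[OF fin]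
        integrable_divide)
  have "(\<integral>x. (if R \<le> norm x then 2 else 1) \<partial>M) \<le> (\<integral>x. 1 + (norm x)\<^sup>2 / R\<^sup>2 \<partial>M)"
  proof (rule integral_mono[OF integrable_norm_threshold[OF fin assms(2)] int'])
    fix x :: 'a
    have "R \<le> norm x \<Longrightarrow> R\<^sup>2 \<le> (norm x)\<^sup>2" using \<open>R > 0\<close> by (intro power_mono) auto
    then show "(if R \<le> norm x then 2 else 1) \<le> 1 + (norm x)\<^sup>2 / R\<^sup>2"
      using \<open>R > 0\<close> by simp
  qed
  also have "\<dots> = 1 + (\<integral>x. (norm x)\<^sup>2 \<partial>M) / R\<^sup>2"
    using int
    by (simp add: finite_measure.integrable_const[OF fin] prob_space.prob_space[OF assms(1)])
  finally show ?thesis .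
qed

text \<open>The majorant is a constant times a product of integrable functions of single samples, so
  its integral factorizes whether or not the count itself is measurable. The interval also records
  nonnegativity, for taking logarithms.\<close>

lemma outer_expectation_num_labelings_bounds:
  fixes M :: "'a::real_inner measure" and \<Delta> :: real and l j :: nat
  assumes prob: "prob_space M" and M: "sets M = sets borel" and "\<Delta> > 0"
    and int: "integrable M (\<lambda>x. (norm x)\<^sup>2)"
  shows "outer_expectation (Pi\<^sub>M {..<l} (\<lambda>_. M))
             (\<lambda>z. real (num_labelings (gap_tolerant_classifiers \<Delta>) l z))
           \<in> {0..(real l + 1) ^ (2 * j + 1)
              * (1 + (\<integral>x. (norm x)\<^sup>2 \<partial>M) / (\<Delta>\<^sup>2 * real (2 * j + 1))) ^ l}"
proof -
  let ?M = "Pi\<^sub>M {..<l} (\<lambda>_. M)"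
  let ?N = "\<lambda>z. real (num_labelings (gap_tolerant_classifiers \<Delta>) l z)"
  define R where "R = \<Delta> * sqrt (real (2 * j + 1))"
  define \<phi> :: "'a \<Rightarrow> real" where "\<phi> = (\<lambda>x. if R \<le> norm x then 2 else 1)"
  define g where "g z = (real l + 1) ^ (2 * j + 1) * (\<Prod>i<l. \<phi> (z i))" for z
  have fin: "finite_measure M"
    using prob by (rule prob_space.finite_measure)
  have prod: "product_sigma_finite (\<lambda>_::nat. M)"
    using prob by (simp add: product_sigma_finite_def prob_space_imp_sigma_finite)
  have R: "R > 0" "R\<^sup>2 = \<Delta>\<^sup>2 * real (2 * j + 1)"
    using \<open>\<Delta> > 0\<close> by (simp_all add: R_def power_mult_distrib)
  have int\<phi>: "integrable M \<phi>"
    unfolding \<phi>_def by (rule integrable_norm_threshold[OF fin M])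
  have E\<phi>: "integral\<^sup>L M \<phi> \<le> 1 + (\<integral>x. (norm x)\<^sup>2 \<partial>M) / (\<Delta>\<^sup>2 * real (2 * j + 1))"
    using integral_norm_threshold_le[OF prob M R(1) int] by (simp only: \<phi>_def R(2))
  have nonneg: "0 \<le> integral\<^sup>L M \<phi>"
    by (rule Bochner_Integration.integral_nonneg) (simp add: \<phi>_def)
  have intg: "integrable ?M g" unfolding g_def
    by (intro integrable_mult_right product_sigma_finite.product_integrable_prod[OF prod]
        finite_lessThan int\<phi>)
  have le: "?N z \<le> g z" for z
    unfolding g_def \<phi>_def R_def by (rule num_labelings_le[OF \<open>\<Delta> > 0\<close>])
  have "outer_expectation ?M ?N \<le> (\<integral>z. g z \<partial>?M)"
    by (rule outer_expectation_le[OF intg le]) simp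
  also have "\<dots> = (real l + 1) ^ (2 * j + 1) * (\<integral>z. (\<Prod>i<l. \<phi> (z i)) \<partial>?M)"
    unfolding g_def by (rule integral_mult_right_zero)
  also have "(\<integral>z. (\<Prod>i<l. \<phi> (z i)) \<partial>?M) = (\<Prod>i<l. integral\<^sup>L M \<phi>)"
    by (rule product_sigma_finite.product_integral_prod[OF prod finite_lessThan int\<phi>])
  also have "\<dots> = integral\<^sup>L M \<phi> ^ l" by simp
  also have "(real l + 1) ^ (2 * j + 1) * \<dots> \<le> (real l + 1) ^ (2 * j + 1)
      * (1 + (\<integral>x. (norm x)\<^sup>2 \<partial>M) / (\<Delta>\<^sup>2 * real (2 * j + 1))) ^ l"
    by (intro mult_left_mono power_mono E\<phi> nonneg) simp
  finally show ?thesis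
    using outer_expectation_nonneg[OF intg le] by simp
qed

text \<open>The optimization over the odd truncation parameter \<open>q = 2 * j + 1\<close>: taking \<open>q\<close> largest
  with \<open>q \<le> s + 1\<close> loses nothing against the real choice \<open>q = s\<close>.\<close>
lemma entropy_exponent_le:
  fixes s L :: real
  assumes "0 \<le> s" and "L \<ge> 1/2 \<or> s = 0"
  defines "j \<equiv> nat \<lfloor>s / 2\<rfloor>"
  shows "s\<^sup>2 / real (2 * j + 1) + real (2 * j + 1) * L \<le> (s + 1) * (1 + L)"
proof (cases "s = 0")
  case True
  then show ?thesis by (simp add: j_def)
next
  case False
  then have L: "L \<ge> 1/2" using assms by simp
  define m where "m = 2 * real j"
  \<comment> \<open>Here \<open>m\<close> is the largest even integer not above \<open>s\<close>, so
    \<open>q = m + 1\<close> is within 1 of \<open>s\<close>.\<close>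
  define f where "f = s - m"
  have m: "m \<ge> 0" by (simp add: m_def)
  have "real j = of_int \<lfloor>s / 2\<rfloor>" using assms by (simp add: j_def)
  then have f: "0 \<le> f" "f \<le> 2" unfolding f_def m_def by linarith+
  have "f * (1/2) \<le> f * (L * (m + 1))"
    using f m L mult_mono[of "1/2" L 1 "m + 1"] by (intro mult_left_mono) auto
  moreover have "0 \<le> m * (2 - f)" "0 \<le> (2 - f) * (f + 1/2)" using m f by auto
  \<comment> \<open>After clearing the denominator \<open>m + 1\<close>, the slack splits into three
    nonnegative parts; the last one uses \<open>L \<ge> 1/2\<close>.\<close>
  moreover have "(s + 1) * (1 + L) * (m + 1) - (s\<^sup>2 + (m + 1) * (m + 1) * L)
      = m * (2 - f) + (2 - f) * (f + 1/2) + (f * (L * (m + 1)) - f * (1/2))"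
    unfolding f_def by (simp add: power2_eq_square field_simps)
  ultimately have "s\<^sup>2 + (m + 1) * (m + 1) * L \<le> (s + 1) * (1 + L) * (m + 1)"
    by linarith
  moreover have "real (2 * j + 1) = m + 1" by (simp add: m_def)
  ultimately show ?thesis using m
    by (simp only:) (simp add: field_simps power2_eq_square)
qed

theorem theorem6:
  fixes P :: "'a::{real_inner, complete_space} measure"
    and \<Delta> r :: real and l :: nat
  assumes "prob_space P" and "sets P = sets borel"
    and "\<Delta> > 0" and "r \<ge> 0"
    and "integrable P (\<lambda>x. (norm x)\<^sup>2)"
    and "(\<integral>x. (norm x)\<^sup>2 \<partial>P) = r\<^sup>2"
  shows "annealed_entropy (gap_tolerant_classifiers \<Delta>) P l
           \<le> (sqrt (real l) * (r / \<Delta>) + 1) * (1 + ln (real l + 1))"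
proof -
  define s where "s = sqrt (real l) * (r / \<Delta>)"
  define L where "L = ln (real l + 1)"
  define j where "j = nat \<lfloor>s / 2\<rfloor>"
  let ?q = "2 * j + 1"
  let ?\<rho> = "r\<^sup>2 / (\<Delta>\<^sup>2 * real ?q)"
  let ?E = "outer_expectation (Pi\<^sub>M {..<l} (\<lambda>_. P))
    (\<lambda>z. real (num_labelings (gap_tolerant_classifiers \<Delta>) l z))"
  have s: "s \<ge> 0" using assms by (simp add: s_def)
  have L: "L \<ge> 0" by (simp add: L_def)
  have \<rho>: "?\<rho> \<ge> 0" by simp
  have "ln ?E \<le> (s + 1) * (1 + L)"
  proof (cases "?E = 0")
    \<comment> \<open>By the convention \<open>ln 0 = 0\<close> this case only asks that the
      right-hand side be nonnegative.\<close>
    case True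
    then show ?thesis using s L by simp
  next
    case False
    note bounds =
      outer_expectation_num_labelings_bounds[OF assms(1,2,3,5), of l j, unfolded assms(6)]
    have "ln ?E \<le> ln ((real l + 1) ^ ?q * (1 + ?\<rho>) ^ l)"
      using False bounds by (intro ln_mono) auto
    also have "\<dots> = real ?q * L + real l * ln (1 + ?\<rho>)"
    proof -
      have "ln (a ^ m * b ^ n) = real m * ln a + real n * ln b"
        if "a > 0" "b > 0" for a b :: real and m n
        using that by (simp add: ln_mult_pos ln_realpow)
      then show ?thesis using \<rho> by (simp add: L_def add_pos_nonneg del: power_Suc)
    qed
    also have "\<dots> \<le> real ?q * L + real l * ?\<rho>"
      using \<rho> by (intro add_left_mono mult_left_mono ln_add_one_self_le_self) auto
    \<comment> \<open>Far points contribute \<open>s\<^sup>2 / q\<close> and near points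
      \<open>q * L\<close>. A real choice \<open>q = s\<close> would give
      \<open>s * (1 + L)\<close>; the extra 1 in \<open>s + 1\<close> pays for \<open>q\<close>
      being odd.\<close>
    also have "real l * ?\<rho> = s\<^sup>2 / real ?q"
      by (simp add: s_def power_mult_distrib power_divide)
    also have "real ?q * L + s\<^sup>2 / real ?q \<le> (s + 1) * (1 + L)"
    proof -
      \<comment> \<open>For \<open>l = 0\<close> the quantity \<open>s\<close> vanishes; otherwise
        \<open>L\<close> is at least \<open>ln 2\<close>.\<close>
      have "L \<ge> 1/2 \<or> s = 0"
      proof (cases l)
        case (Suc n)
        have "1/2 \<le> ln (2::real)" using ln2_ge_two_thirds by simp
        also have "\<dots> \<le> L" unfolding L_def using Suc by (intro ln_mono) auto
        finally show ?thesis ..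
      qed (simp add: s_def)
      then show ?thesis
        using entropy_exponent_le[OF s, of L] by (simp add: j_def add.commute)
    qed
    finally show ?thesis .
  qed
  then show ?thesis by (simp add: annealed_entropy_def s_def L_def)
qed

end
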